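(* Consider the power system problem of the context, with uncertainty set $\Omega$ (a polytope) represented as $\{P\in\mathbb{R}^{\mathcal{N}_{DG}\times T}_{\ge 0}: A_\Omega^\top P+\eta=b_\Omega \text{ for some } \eta\ge 0\}$, where $\eta$ are nonnegative slack variables in the rows. Let $\beta^-_{i,t},\beta^+_{i,t}$ be a lower and an upper bound for $\beta_{DG_i,t}$ ($i\in\mathcal{N}_{DG},t\in T$), in the sense of the Boundedness Assumption of the context. Then the optimal value of the following mixed-integer program is an upper bound on the optimal value of the trilevel mixed-integer problem $\min_{x\in\mathcal{X}}G(x)+\max_{h\in\Omega}\min_{y\in\mathcal{Y}(x,h)}c^\top y$ of the context: $$\begin{aligned} \min\ & \sum_{i\in\mathcal{N}_G,t\in T}\left(c_{G_i^t,2}(P_{G_i}^t)^2+c_{G_i^t,1}P_{G_i}^t+c_{G_i^t,0}\right)+\sum_{t\in T}p_{fl}^tP_{fl}^t+c^\top y\\ &+\sum_{i\in\mathcal{N}_{DG},t\in T}\left(\beta^+_{i,t}u^{\beta,+}_{i,t}+\beta^-_{i,t}u^{\beta,-}_{i,t}\right)+b_\Omega^\top u_\Omega\\ &-\sum_{i\in\mathcal{N}_{DG},t\in T}\left(P_{DG_i,\min}^t\beta^-_{i,t}u^1_{i,t}+P^+_{i,t}\beta^+_{i,t}u^2_{i,t}+P^+_{i,t}\beta^-_{i,t}u^3_{i,t}+P_{DG_i,\min}^t\beta^+_{i,t}u^4_{i,t}\right)\\ \text{s.t. } & Ay\ge b,\\ & -P_{DG_i}^t+u^{\beta,+}_{i,t}+u^{\beta,-}_{i,t}-P_{DG_i,\min}^tu^1_{i,t}-P^+_{i,t}u^2_{i,t}-P^+_{i,t}u^3_{i,t}-P_{DG_i,\min}^tu^4_{i,t}\ge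 0,\\ & u^{\beta,+}_{i,t}\ge 0,\quad -u^{\beta,-}_{i,t}\ge 0,\\ & (A_\Omega u_\Omega)_{i,t}-\beta^-_{i,t}(u^1_{i,t}+u^3_{i,t})-\beta^+_{i,t}(u^2_{i,t}+u^4_{i,t})\ge 0,\\ & u_\Omega\ge 0,\\ & u^1_{i,t}+u^2_{i,t}+u^3_{i,t}+u^4_{i,t}\ge -1,\\ & -u^1_{i,t}\ge 0,\quad -u^2_{i,t}\ge 0,\quad u^3_{i,t}\ge 0,\quad u^4_{i,t}\ge 0,\\ & (P_G,P_{fl})\in\mathcal{X},\\ & \mu_{ch},\mu_{dch}\in\{0,1\}^{\mathcal{N}_S\times T}, \end{aligned}$$ where all constraints indexed by $i,t$ are imposed for every $i\in\mathcal{N}_{DG}$, $t\in T$, and all variables $P_{G_i}^t,P_{fl}^t$, the components of $y$ other than $\mu_{ch},\mu_{dch}$, $u^{\beta,\pm}_{i,t}$, $u_\Omega$, $u^1_{i,t},\dots,u^4_{i,t}$ are real.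
   Context: Data. $T$ is a finite set of consecutive time steps; $\mathcal{B}$ is a finite set of buses with root bus $0$; $\mathcal{L}$ is the set of lines (unordered pairs of buses) with reactances $x_{ij}=x_{ji}>0$ and capacities $s_{ij,\max}$; $\delta(k)$ is the set of buses adjacent to $k$. $\mathcal{N}_G,\mathcal{N}_{DG},\mathcal{N}_S$ are the finite sets of conventional generators, distributed (renewable) generators and storages; $i\sim k$ means that unit $i$ is connected to bus $k$. All other quantities below that are not declared variables are given real parameters (demands $P_k^{d,t}=P_{d_k}^t$, prices $p_{fl}^t,p_{sl}^t$, costs $c_{G_i^t,\cdot}$, $r_i^{\pm,t}$, $f_i^\pm$, forecasts $P_{DG_i,forecast}^t$, bounds with subscripts $\min,\max$, technical limits $P_i^+$, storage capacities $E_i>0$, step length $\Delta T$, initial states of charge, $R\in[0,1]$). First level. $x=(P_G,P_{fl})$, and $\mathcal{X}$ is the set of $x$ with, for all $t\in T$, $P_{fl}^t=\sum_{i\in\mathcal{B}}P_{d_i}^t-\sum_{i\in\mathcal{N}_G}P_{G_i}^t-\sum_{i\in\mathcal{N}_{DG}}P_{DG_i,forecast}^t$ and $P_{G_i,\min}^t\le P_{G_i}^t\le P_{G_i,\max}^t$ for $i\in\mathcal{N}_G$. The cost is $G(x)=\sum_{i\in\mathcal{N}_G,t\in T}(c_{G_i^t,2}(P_{G_i}^t)^2+c_{G_i^t,1}P_{G_i}^t+c_{G_i^t,0})+\sum_{t\in T}p_{fl}^tP_{fl}^t$. Second level. $h=P_{DG,\max}=(P_{DG_i,\max}^t)_{i\in\mathcal{N}_{DG},t\in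 T}$ and $$\Omega=\Big\{P_{DG,\max}\in\mathbb{R}^{\mathcal{N}_{DG}\times T}: 0\le P_{DG_i,\max}^t\le P_i^+\ \forall i,t,\ \ \sum_{i\in\mathcal{N}_{DG}}P_{DG_i,\max}^t\ge R\sum_{i\in\mathcal{N}_{DG}}P_{DG_i,forecast}^t\ \forall t\Big\}.$$ Third level. $y$ collects the variables $P_{G_i,\mathrm{reg}}^t,P_{G_i}^{t,+},P_{G_i}^{t,-}$ ($i\in\mathcal{N}_G$), $P_{DG_i}^t,P_{DG_i}^{t,+},P_{DG_i}^{t,-}$ ($i\in\mathcal{N}_{DG}$), $P_{sl}^t$, $P_{ch_i}^t,P_{dch_i}^t,\mathrm{soc}_i^t,\mu_{ch_i}^t,\mu_{dch_i}^t$ ($i\in\mathcal{N}_S$), the line flows $p_{kl}^t$ and phase angles $\theta_k^t$, for $t\in T$. $\mathcal{Y}(x,h)$ is the set of all $y$ satisfying, for all $t\in T$ and all units, buses and lines concerned: (1) $P_{G_i,\mathrm{reg}}^t=P_{G_i}^t+P_{G_i}^{t,+}+P_{G_i}^{t,-}$; $P_{G_i,\min}^t\le P_{G_i,\mathrm{reg}}^t\le P_{G_i,\max}^t$; $P_{DG_i}^t=P_{DG_i,forecast}^t+P_{DG_i}^{t,+}+P_{DG_i}^{t,-}$; $P_{DG_i,\min}^t\le P_{DG_i}^t\le P_{DG_i,\max}^t$; $P_{sl}^t-P_{fl}^t=-\sum_{i\in\mathcal{N}_G}(P_{G_i}^{t,+}+P_{G_i}^{t,-})-\sum_{i\in\mathcal{N}_{DG}}(P_{DG_i}^{t,+}+P_{DG_i}^{t,-})-\sum_{i\in\mathcal{N}_S}(P_{dch_i}^t-P_{ch_i}^t)$;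 (2) $0\le P_{G_i}^{t,+}\le P_{G_i,\max}^{t,+}$; $P_{G_i,\min}^{t,-}\le P_{G_i}^{t,-}\le 0$; $P_{DG_i}^{t,+}\ge 0$; $P_{DG_i}^{t,-}\le 0$; (3) for every bus $k$: $\sum_{i\in\mathcal{N}_G:i\sim k}P_{G_i,\mathrm{reg}}^t+\sum_{i\in\mathcal{N}_{DG}:i\sim k}P_{DG_i}^t+\sum_{i\in\mathcal{N}_S:i\sim k}(P_{dch_i}^t-P_{ch_i}^t)+\epsilon_kP_{sl}^t-P_k^{d,t}=\sum_{l\in\delta(k)}p_{kl}^t$, where $\epsilon_0=1$ and $\epsilon_k=0$ for $k\ne 0$; and $p_{ij}^t=\frac{1}{x_{ij}}(\theta_i^t-\theta_j^t)$ for $\{i,j\}\in\mathcal{L}$; (4) $-s_{ij,\max}\le p_{ij}^t\le s_{ij,\max}$ for $\{i,j\}\in\mathcal{L}$; (5) for $i\in\mathcal{N}_S$: $\mathrm{soc}_{i,\min}^t\le\mathrm{soc}_i^t\le\mathrm{soc}_{i,\max}^t$; $\mathrm{soc}_i^t=\mathrm{soc}_i^{t-1}+\frac{P_{ch_i}^t-P_{dch_i}^t}{E_i}\Delta T$; $P_{ch_i}^t,P_{dch_i}^t\ge 0$; $\mu_{ch_i}^t,\mu_{dch_i}^t\in\{0,1\}$; $\mu_{ch_i}^tP_{ch_i,\min}^t\le P_{ch_i}^t\le\mu_{ch_i}^tP_{ch_i,\max}^t$; $\mu_{dch_i}^tP_{dch_i,\min}^t\le P_{dch_i}^t\le\mu_{dch_i}^tP_{dch_i,\max}^t$;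 $\mu_{ch_i}^t+\mu_{dch_i}^t\le 1$. The third-level cost, denoted $c^\top y$ (it contains the term $-\sum_tp_{sl}^tP_{fl}^t$, constant in $y$), is $$c^\top y=\sum_{t\in T}\Big(\sum_{i\in\mathcal{N}_G}(r_i^{+,t}P_{G_i}^{t,+}+r_i^{-,t}P_{G_i}^{t,-})+p_{sl}^t(P_{sl}^t-P_{fl}^t)+\sum_{i\in\mathcal{N}_{DG}}(f_i^+P_{DG_i}^{t,+}+f_i^-P_{DG_i}^{t,-})\Big).$$ Notation $Ay\ge b$. This denotes the system of all linear constraints in (1)–(5) except the upper bounds $P_{DG_i}^t\le P_{DG_i,\max}^t$ and the integrality requirements; its right-hand side depends affinely on $x=(P_G,P_{fl})$. The remaining constraints are $-P_{DG_i}^t\ge -P_{DG_i,\max}^t$ ($i\in\mathcal{N}_{DG},t\in T$). Boundedness Assumption. For each fixed binary choice of $(\mu_{ch},\mu_{dch})$, the third-level problem is an LP; $\beta_{DG_i,t}\ge 0$ denotes the variable of its LP dual corresponding to $-P_{DG_i}^t\ge -P_{DG_i,\max}^t$ (so the dual objective depends on $h$ only through $-\sum_{i,t}P_{DG_i,\max}^t\beta_{DG_i,t}$). There are reals $P_{i,t}^+$, $\beta_{i,t}^-\le\beta_{i,t}^+$ such that adding $P_{DG_i,\min}^t\le P_{DG_i,\max}^t\le P_{i,t}^+$ to $\Omega$ and $\beta_{i,t}^-\le\beta_{DG_i,t}\le\beta_{i,t}^+$ to the dual does not affect the outcome: for every fixed binary $(\mu_{ch},\mu_{dch})$, the trilevel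 problem with these binaries fixed has the same optimal value as the problem obtained by adding these bounds to $\Omega$ and replacing the third-level LP by its dual with the bounds on $\beta$ added. *)

theory Defs
  imports "HOL-Analysis.Analysis"
begin

section \<open>Data of the power system\<close>

text \<open>
  Index sets are carrier sets (and may be empty); families indexed by them are total functions of
  which only the values on the carriers are ever used.  A line is a two-element set of buses, so
  that reactances and capacities, being functions of the line, are symmetric by construction.
\<close>

record ('b, 'g, 'd, 's) power_system =
  t_first :: int
  t_last :: int
  buses :: "'b set"
  root_bus :: 'b
  lines :: "'b set set"
  reactance :: "'b set \<Rightarrow> real"
  capacity :: "'b set \<Rightarrow> real"
  gens :: "'g set"
  dgs :: "'d set"
  stores :: "'s set"
  gen_at :: "'g \<Rightarrow> 'b \<Rightarrow> bool"
  dg_at :: "'d \<Rightarrow> 'b \<Rightarrow> bool"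
  store_at :: "'s \<Rightarrow> 'b \<Rightarrow> bool"
  demand :: "'b \<Rightarrow> int \<Rightarrow> real"
  forecast :: "'d \<Rightarrow> int \<Rightarrow> real"
  price_fl :: "int \<Rightarrow> real"
  price_sl :: "int \<Rightarrow> real"
  cost_G2 :: "'g \<Rightarrow> int \<Rightarrow> real"
  cost_G1 :: "'g \<Rightarrow> int \<Rightarrow> real"
  cost_G0 :: "'g \<Rightarrow> int \<Rightarrow> real"
  r_plus :: "'g \<Rightarrow> int \<Rightarrow> real"
  r_minus :: "'g \<Rightarrow> int \<Rightarrow> real"
  f_plus :: "'d \<Rightarrow> real"
  f_minus :: "'d \<Rightarrow> real"
  PG_min :: "'g \<Rightarrow> int \<Rightarrow> real"
  PG_max :: "'g \<Rightarrow> int \<Rightarrow> real"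
  PGplus_max :: "'g \<Rightarrow> int \<Rightarrow> real"
  PGminus_min :: "'g \<Rightarrow> int \<Rightarrow> real"
  PDG_min :: "'d \<Rightarrow> int \<Rightarrow> real"
  PDG_limit :: "'d \<Rightarrow> real"
  soc_min :: "'s \<Rightarrow> int \<Rightarrow> real"
  soc_max :: "'s \<Rightarrow> int \<Rightarrow> real"
  soc_init :: "'s \<Rightarrow> real"
  Pch_min :: "'s \<Rightarrow> int \<Rightarrow> real"
  Pch_max :: "'s \<Rightarrow> int \<Rightarrow> real"
  Pdch_min :: "'s \<Rightarrow> int \<Rightarrow> real"
  Pdch_max :: "'s \<Rightarrow> int \<Rightarrow> real"
  store_cap :: "'s \<Rightarrow> real"
  step_len :: real
  ratio_R :: real

definition steps :: "('b, 'g, 'd, 's) power_system \<Rightarrow> int set" where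
  "steps ps = {t_first ps..t_last ps}"

definition nbrs :: "('b, 'g, 'd, 's) power_system \<Rightarrow> 'b \<Rightarrow> 'b set" where
  "nbrs ps k = {l \<in> buses ps. {k, l} \<in> lines ps}"

definition wf_system :: "('b, 'g, 'd, 's) power_system \<Rightarrow> bool" where
  "wf_system ps \<longleftrightarrow>
     finite (buses ps) \<and> root_bus ps \<in> buses ps \<and>
     lines ps \<subseteq> {{i, j} |i j. i \<in> buses ps \<and> j \<in> buses ps \<and> i \<noteq> j} \<and>
     (\<forall>e\<in>lines ps. reactance ps e > 0) \<and>
     finite (gens ps) \<and> finite (dgs ps) \<and> finite (stores ps) \<and>
     (\<forall>i\<in>stores ps. store_cap ps i > 0) \<and>
     0 \<le> ratio_R ps \<and> ratio_R ps \<le> 1"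


section \<open>First and second level\<close>

record 'g first_stage =
  PG :: "'g \<Rightarrow> int \<Rightarrow> real"
  Pfl :: "int \<Rightarrow> real"

definition first_set :: "('b, 'g, 'd, 's) power_system \<Rightarrow> 'g first_stage set" where
  "first_set ps = {x. \<forall>t\<in>steps ps.
     Pfl x t = (\<Sum>i\<in>buses ps. demand ps i t) - (\<Sum>i\<in>gens ps. PG x i t)
               - (\<Sum>i\<in>dgs ps. forecast ps i t) \<and>
     (\<forall>i\<in>gens ps. PG_min ps i t \<le> PG x i t \<and> PG x i t \<le> PG_max ps i t)}"

definition first_cost :: "('b, 'g, 'd, 's) power_system \<Rightarrow> 'g first_stage \<Rightarrow> real" where
  "first_cost ps x =
     (\<Sum>i\<in>gens ps. \<Sum>t\<in>steps ps.
        cost_G2 ps i t * (PG x i t)\<^sup>2 + cost_G1 ps i t * PG x i t + cost_G0 ps i t)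
     + (\<Sum>t\<in>steps ps. price_fl ps t * Pfl x t)"

definition Omega :: "('b, 'g, 'd, 's) power_system \<Rightarrow> ('d \<Rightarrow> int \<Rightarrow> real) set" where
  "Omega ps = {h.
     (\<forall>i\<in>dgs ps. \<forall>t\<in>steps ps. 0 \<le> h i t \<and> h i t \<le> PDG_limit ps i) \<and>
     (\<forall>t\<in>steps ps. (\<Sum>i\<in>dgs ps. h i t) \<ge> ratio_R ps * (\<Sum>i\<in>dgs ps. forecast ps i t))}"


section \<open>Third level\<close>

text \<open>A third-level decision is a vector indexed by the names of the variables.\<close>

datatype ('b, 'g, 'd, 's) yvar =
    PGreg 'g int | PGplus 'g int | PGminus 'g int
  | PDG 'd int | PDGplus 'd int | PDGminus 'd int
  | Psl int
  | Pch 's int | Pdch 's int | Soc 's int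
  | MuCh 's int | MuDch 's int
  | Flow 'b 'b int | Theta 'b int

type_synonym ('b, 'g, 'd, 's) yvec = "('b, 'g, 'd, 's) yvar \<Rightarrow> real"

definition bin_vars :: "('b, 'g, 'd, 's) power_system \<Rightarrow> ('b, 'g, 'd, 's) yvar set" where
  "bin_vars ps = case_prod MuCh ` (stores ps \<times> steps ps) \<union> case_prod MuDch ` (stores ps \<times> steps ps)"

definition cont_vars :: "('b, 'g, 'd, 's) power_system \<Rightarrow> ('b, 'g, 'd, 's) yvar set" where
  "cont_vars ps =
     case_prod PGreg ` (gens ps \<times> steps ps) \<union> case_prod PGplus ` (gens ps \<times> steps ps)
     \<union> case_prod PGminus ` (gens ps \<times> steps ps)
     \<union> case_prod PDG ` (dgs ps \<times> steps ps) \<union> case_prod PDGplus ` (dgs ps \<times> steps ps)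
     \<union> case_prod PDGminus ` (dgs ps \<times> steps ps)
     \<union> Psl ` steps ps
     \<union> case_prod Pch ` (stores ps \<times> steps ps) \<union> case_prod Pdch ` (stores ps \<times> steps ps)
     \<union> case_prod Soc ` (stores ps \<times> steps ps)
     \<union> {Flow k l t |k l t. k \<in> buses ps \<and> l \<in> nbrs ps k \<and> t \<in> steps ps}
     \<union> case_prod Theta ` (buses ps \<times> steps ps)"

text \<open>
  The flow on a line is a variable for each of its two orientations; both orientations
  of every line obey the flow equation.
\<close>

definition regulation :: "('b, 'g, 'd, 's) power_system \<Rightarrow> 'g first_stage \<Rightarrow> ('b, 'g, 'd, 's) yvec \<Rightarrow> bool" where
  "regulation ps x y \<longleftrightarrow> (\<forall>t\<in>steps ps.
     (\<forall>i\<in>gens ps.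
        y (PGreg i t) = PG x i t + y (PGplus i t) + y (PGminus i t) \<and>
        PG_min ps i t \<le> y (PGreg i t) \<and> y (PGreg i t) \<le> PG_max ps i t) \<and>
     (\<forall>i\<in>dgs ps.
        y (PDG i t) = forecast ps i t + y (PDGplus i t) + y (PDGminus i t) \<and>
        PDG_min ps i t \<le> y (PDG i t)) \<and>
     y (Psl t) - Pfl x t =
        - (\<Sum>i\<in>gens ps. y (PGplus i t) + y (PGminus i t))
        - (\<Sum>i\<in>dgs ps. y (PDGplus i t) + y (PDGminus i t))
        - (\<Sum>i\<in>stores ps. y (Pdch i t) - y (Pch i t)))"

definition regulation_bounds :: "('b, 'g, 'd, 's) power_system \<Rightarrow> ('b, 'g, 'd, 's) yvec \<Rightarrow> bool" where
  "regulation_bounds ps y \<longleftrightarrow> (\<forall>t\<in>steps ps.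
     (\<forall>i\<in>gens ps.
        0 \<le> y (PGplus i t) \<and> y (PGplus i t) \<le> PGplus_max ps i t \<and>
        PGminus_min ps i t \<le> y (PGminus i t) \<and> y (PGminus i t) \<le> 0) \<and>
     (\<forall>i\<in>dgs ps. y (PDGplus i t) \<ge> 0 \<and> y (PDGminus i t) \<le> 0))"

definition network :: "('b, 'g, 'd, 's) power_system \<Rightarrow> ('b, 'g, 'd, 's) yvec \<Rightarrow> bool" where
  "network ps y \<longleftrightarrow> (\<forall>t\<in>steps ps.
     (\<forall>k\<in>buses ps.
        (\<Sum>i | i \<in> gens ps \<and> gen_at ps i k. y (PGreg i t))
        + (\<Sum>i | i \<in> dgs ps \<and> dg_at ps i k. y (PDG i t))
        + (\<Sum>i | i \<in> stores ps \<and> store_at ps i k. y (Pdch i t) - y (Pch i t))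
        + (if k = root_bus ps then 1 else 0) * y (Psl t) - demand ps k t
        = (\<Sum>l\<in>nbrs ps k. y (Flow k l t))) \<and>
     (\<forall>i j. {i, j} \<in> lines ps \<longrightarrow>
        y (Flow i j t) = 1 / reactance ps {i, j} * (y (Theta i t) - y (Theta j t))))"

definition line_limits :: "('b, 'g, 'd, 's) power_system \<Rightarrow> ('b, 'g, 'd, 's) yvec \<Rightarrow> bool" where
  "line_limits ps y \<longleftrightarrow> (\<forall>t\<in>steps ps. \<forall>i j. {i, j} \<in> lines ps \<longrightarrow>
     - capacity ps {i, j} \<le> y (Flow i j t) \<and> y (Flow i j t) \<le> capacity ps {i, j})"

definition storage :: "('b, 'g, 'd, 's) power_system \<Rightarrow> ('b, 'g, 'd, 's) yvec \<Rightarrow> bool" where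
  "storage ps y \<longleftrightarrow> (\<forall>t\<in>steps ps. \<forall>i\<in>stores ps.
     soc_min ps i t \<le> y (Soc i t) \<and> y (Soc i t) \<le> soc_max ps i t \<and>
     y (Soc i t) = (if t = t_first ps then soc_init ps i else y (Soc i (t - 1)))
                   + (y (Pch i t) - y (Pdch i t)) / store_cap ps i * step_len ps \<and>
     y (Pch i t) \<ge> 0 \<and> y (Pdch i t) \<ge> 0 \<and>
     y (MuCh i t) * Pch_min ps i t \<le> y (Pch i t) \<and> y (Pch i t) \<le> y (MuCh i t) * Pch_max ps i t \<and>
     y (MuDch i t) * Pdch_min ps i t \<le> y (Pdch i t) \<and> y (Pdch i t) \<le> y (MuDch i t) * Pdch_max ps i t \<and>
     y (MuCh i t) + y (MuDch i t) \<le> 1)"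

text \<open>
  The system \<open>A y \<ge> b\<close>: everything except the upper bounds \<open>P\<^sub>D\<^sub>G \<le> h\<close> and integrality.
\<close>

definition Ay_ge_b :: "('b, 'g, 'd, 's) power_system \<Rightarrow> 'g first_stage \<Rightarrow> ('b, 'g, 'd, 's) yvec \<Rightarrow> bool" where
  "Ay_ge_b ps x y \<longleftrightarrow>
     regulation ps x y \<and> regulation_bounds ps y \<and> network ps y \<and> line_limits ps y \<and> storage ps y"

definition binary :: "('b, 'g, 'd, 's) power_system \<Rightarrow> ('b, 'g, 'd, 's) yvec \<Rightarrow> bool" where
  "binary ps y \<longleftrightarrow> (\<forall>v\<in>bin_vars ps. y v \<in> {0, 1})"

definition third_set ::
  "('b, 'g, 'd, 's) power_system \<Rightarrow> 'g first_stage \<Rightarrow> ('d \<Rightarrow> int \<Rightarrow> real) \<Rightarrow> ('b, 'g, 'd, 's) yvec set" where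
  "third_set ps x h =
     {y. Ay_ge_b ps x y \<and> (\<forall>i\<in>dgs ps. \<forall>t\<in>steps ps. y (PDG i t) \<le> h i t) \<and> binary ps y}"

definition third_cost ::
  "('b, 'g, 'd, 's) power_system \<Rightarrow> 'g first_stage \<Rightarrow> ('b, 'g, 'd, 's) yvec \<Rightarrow> real" where
  "third_cost ps x y = (\<Sum>t\<in>steps ps.
     (\<Sum>i\<in>gens ps. r_plus ps i t * y (PGplus i t) + r_minus ps i t * y (PGminus i t))
     + price_sl ps t * (y (Psl t) - Pfl x t)
     + (\<Sum>i\<in>dgs ps. f_plus ps i * y (PDGplus i t) + f_minus ps i * y (PDGminus i t)))"

text \<open>
  Optimal values are infima and suprema in the extended reals, so an infeasible minimisation
  has value \<open>\<infinity>\<close> and an infeasible maximisation has value \<open>-\<infinity>\<close>.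
\<close>

definition trilevel_value :: "('b, 'g, 'd, 's) power_system \<Rightarrow> ereal" where
  "trilevel_value ps =
     (INF x\<in>first_set ps. ereal (first_cost ps x)
        + (SUP h\<in>Omega ps. INF y\<in>third_set ps x h. ereal (third_cost ps x y)))"


section \<open>The third-level LP for fixed binaries and its dual\<close>

text \<open>
  Row \<open>r\<close> of the system reads \<open>row_lhs ps r y = row_rhs ps x r\<close> for \<open>r\<close> in \<open>eq_rows\<close>
  and \<open>row_lhs ps r y \<ge> row_rhs ps x r\<close> for \<open>r\<close> in \<open>ge_rows\<close>;
  the lemma \<open>Ay_ge_b_rows\<close> below states that this is the system \<open>Ay_ge_b\<close>.
\<close>

datatype ('b, 'g, 'd, 's) row =
    EqReg 'g int | EqDG 'd int | EqSl int | EqBus 'b int | EqFlow 'b 'b int | EqSoc 's int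
  | RegLo 'g int | RegUp 'g int | DGLo 'd int
  | GplusLo 'g int | GplusUp 'g int | GminusLo 'g int | GminusUp 'g int
  | DGplusLo 'd int | DGminusUp 'd int
  | FlowLo 'b 'b int | FlowUp 'b 'b int
  | SocLo 's int | SocUp 's int | ChNonneg 's int | DchNonneg 's int
  | ChLo 's int | ChUp 's int | DchLo 's int | DchUp 's int | MuSum 's int

definition eq_rows :: "('b, 'g, 'd, 's) power_system \<Rightarrow> ('b, 'g, 'd, 's) row set" where
  "eq_rows ps =
     case_prod EqReg ` (gens ps \<times> steps ps) \<union> case_prod EqDG ` (dgs ps \<times> steps ps)
     \<union> EqSl ` steps ps \<union> case_prod EqBus ` (buses ps \<times> steps ps)
     \<union> {EqFlow k l t |k l t. k \<in> buses ps \<and> l \<in> nbrs ps k \<and> t \<in> steps ps}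
     \<union> case_prod EqSoc ` (stores ps \<times> steps ps)"

definition ge_rows :: "('b, 'g, 'd, 's) power_system \<Rightarrow> ('b, 'g, 'd, 's) row set" where
  "ge_rows ps =
     (\<Union>f\<in>{RegLo, RegUp, GplusLo, GplusUp, GminusLo, GminusUp}. case_prod f ` (gens ps \<times> steps ps))
     \<union> (\<Union>f\<in>{DGLo, DGplusLo, DGminusUp}. case_prod f ` (dgs ps \<times> steps ps))
     \<union> (\<Union>f\<in>{FlowLo, FlowUp}. {f k l t |k l t. k \<in> buses ps \<and> l \<in> nbrs ps k \<and> t \<in> steps ps})
     \<union> (\<Union>f\<in>{SocLo, SocUp, ChNonneg, DchNonneg, ChLo, ChUp, DchLo, DchUp, MuSum}.
          case_prod f ` (stores ps \<times> steps ps))"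

primrec row_lhs ::
  "('b, 'g, 'd, 's) power_system \<Rightarrow> ('b, 'g, 'd, 's) row \<Rightarrow> ('b, 'g, 'd, 's) yvec \<Rightarrow> real" where
  "row_lhs ps (EqReg i t) y = y (PGreg i t) - y (PGplus i t) - y (PGminus i t)"
| "row_lhs ps (EqDG i t) y = y (PDG i t) - y (PDGplus i t) - y (PDGminus i t)"
| "row_lhs ps (EqSl t) y = y (Psl t)
     + (\<Sum>i\<in>gens ps. y (PGplus i t) + y (PGminus i t))
     + (\<Sum>i\<in>dgs ps. y (PDGplus i t) + y (PDGminus i t))
     + (\<Sum>i\<in>stores ps. y (Pdch i t) - y (Pch i t))"
| "row_lhs ps (EqBus k t) y =
     (\<Sum>i | i \<in> gens ps \<and> gen_at ps i k. y (PGreg i t))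
     + (\<Sum>i | i \<in> dgs ps \<and> dg_at ps i k. y (PDG i t))
     + (\<Sum>i | i \<in> stores ps \<and> store_at ps i k. y (Pdch i t) - y (Pch i t))
     + (if k = root_bus ps then 1 else 0) * y (Psl t)
     - (\<Sum>l\<in>nbrs ps k. y (Flow k l t))"
| "row_lhs ps (EqFlow i j t) y =
     y (Flow i j t) - 1 / reactance ps {i, j} * (y (Theta i t) - y (Theta j t))"
| "row_lhs ps (EqSoc i t) y =
     y (Soc i t) - (if t = t_first ps then 0 else y (Soc i (t - 1)))
     - (y (Pch i t) - y (Pdch i t)) / store_cap ps i * step_len ps"
| "row_lhs ps (RegLo i t) y = y (PGreg i t)"
| "row_lhs ps (RegUp i t) y = - y (PGreg i t)"
| "row_lhs ps (DGLo i t) y = y (PDG i t)"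
| "row_lhs ps (GplusLo i t) y = y (PGplus i t)"
| "row_lhs ps (GplusUp i t) y = - y (PGplus i t)"
| "row_lhs ps (GminusLo i t) y = y (PGminus i t)"
| "row_lhs ps (GminusUp i t) y = - y (PGminus i t)"
| "row_lhs ps (DGplusLo i t) y = y (PDGplus i t)"
| "row_lhs ps (DGminusUp i t) y = - y (PDGminus i t)"
| "row_lhs ps (FlowLo i j t) y = y (Flow i j t)"
| "row_lhs ps (FlowUp i j t) y = - y (Flow i j t)"
| "row_lhs ps (SocLo i t) y = y (Soc i t)"
| "row_lhs ps (SocUp i t) y = - y (Soc i t)"
| "row_lhs ps (ChNonneg i t) y = y (Pch i t)"
| "row_lhs ps (DchNonneg i t) y = y (Pdch i t)"
| "row_lhs ps (ChLo i t) y = y (Pch i t) - y (MuCh i t) * Pch_min ps i t"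
| "row_lhs ps (ChUp i t) y = y (MuCh i t) * Pch_max ps i t - y (Pch i t)"
| "row_lhs ps (DchLo i t) y = y (Pdch i t) - y (MuDch i t) * Pdch_min ps i t"
| "row_lhs ps (DchUp i t) y = y (MuDch i t) * Pdch_max ps i t - y (Pdch i t)"
| "row_lhs ps (MuSum i t) y = - y (MuCh i t) - y (MuDch i t)"

primrec row_rhs ::
  "('b, 'g, 'd, 's) power_system \<Rightarrow> 'g first_stage \<Rightarrow> ('b, 'g, 'd, 's) row \<Rightarrow> real" where
  "row_rhs ps x (EqReg i t) = PG x i t"
| "row_rhs ps x (EqDG i t) = forecast ps i t"
| "row_rhs ps x (EqSl t) = Pfl x t"
| "row_rhs ps x (EqBus k t) = demand ps k t"
| "row_rhs ps x (EqFlow i j t) = 0"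
| "row_rhs ps x (EqSoc i t) = (if t = t_first ps then soc_init ps i else 0)"
| "row_rhs ps x (RegLo i t) = PG_min ps i t"
| "row_rhs ps x (RegUp i t) = - PG_max ps i t"
| "row_rhs ps x (DGLo i t) = PDG_min ps i t"
| "row_rhs ps x (GplusLo i t) = 0"
| "row_rhs ps x (GplusUp i t) = - PGplus_max ps i t"
| "row_rhs ps x (GminusLo i t) = PGminus_min ps i t"
| "row_rhs ps x (GminusUp i t) = 0"
| "row_rhs ps x (DGplusLo i t) = 0"
| "row_rhs ps x (DGminusUp i t) = 0"
| "row_rhs ps x (FlowLo i j t) = - capacity ps {i, j}"
| "row_rhs ps x (FlowUp i j t) = - capacity ps {i, j}"
| "row_rhs ps x (SocLo i t) = soc_min ps i t"
| "row_rhs ps x (SocUp i t) = - soc_max ps i t"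
| "row_rhs ps x (ChNonneg i t) = 0"
| "row_rhs ps x (DchNonneg i t) = 0"
| "row_rhs ps x (ChLo i t) = 0"
| "row_rhs ps x (ChUp i t) = 0"
| "row_rhs ps x (DchLo i t) = 0"
| "row_rhs ps x (DchUp i t) = 0"
| "row_rhs ps x (MuSum i t) = - 1"

lemma Ay_ge_b_rows:
  assumes "wf_system ps"
  shows "Ay_ge_b ps x y \<longleftrightarrow>
           (\<forall>r\<in>eq_rows ps. row_lhs ps r y = row_rhs ps x r) \<and>
           (\<forall>r\<in>ge_rows ps. row_lhs ps r y \<ge> row_rhs ps x r)"
proof -
  have line: "k \<in> buses ps \<and> l \<in> nbrs ps k \<longleftrightarrow> {k, l} \<in> lines ps" for k l
    using assms unfolding wf_system_def nbrs_def by (auto simp: doubleton_eq_iff subset_iff)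
  have on_lines: "(\<forall>r\<in>{f k l t |k l t. k \<in> buses ps \<and> l \<in> nbrs ps k \<and> t \<in> steps ps}. P r) \<longleftrightarrow>
      (\<forall>t\<in>steps ps. \<forall>i j. {i, j} \<in> lines ps \<longrightarrow> P (f i j t))"
    for f :: "'a \<Rightarrow> 'a \<Rightarrow> int \<Rightarrow> ('a, 'b, 'c, 'd) row" and P
    unfolding line[symmetric] by blast
  have on_units: "(\<forall>r\<in>case_prod f ` (S \<times> steps ps). P r) \<longleftrightarrow> (\<forall>t\<in>steps ps. \<forall>i\<in>S. P (f i t))"
    for f :: "'x \<Rightarrow> int \<Rightarrow> ('a, 'b, 'c, 'd) row" and S P
    by auto
  have on_steps: "(\<forall>r\<in>f ` steps ps. P r) \<longleftrightarrow> (\<forall>t\<in>steps ps. P (f t))"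
    for f :: "int \<Rightarrow> ('a, 'b, 'c, 'd) row" and P
    by auto
  have bus: "a + b + c + d - e = row_rhs ps x (EqBus k t) \<longleftrightarrow> a + b + c + d - demand ps k t = e"
    for a b c d e :: real and k t
    by auto
  have sl: "p + a + b + c = q \<longleftrightarrow> p - q = - a - b - c" for a b c p q :: real
    by linarith
  have reg: "p - a - b = q \<longleftrightarrow> p = q + a + b" for a b p q :: real
    by linarith
  have flow: "p - a = 0 \<longleftrightarrow> p = a" for a p :: real
    by linarith
  have soc: "(if c then p else 0) + (if c then 0 else q) = (if c then p else q)" for p q :: real and c
    by auto
  have ineq: "- a \<le> - b \<longleftrightarrow> b \<le> a" "0 \<le> - a \<longleftrightarrow> a \<le> 0" "- 1 \<le> - a - b \<longleftrightarrow> a + b \<le> 1"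
      "0 \<le> a - b \<longleftrightarrow> b \<le> a" for a b :: real
    by auto
  show ?thesis
    unfolding Ay_ge_b_def regulation_def regulation_bounds_def network_def line_limits_def storage_def
      eq_rows_def ge_rows_def
    unfolding ball_Un UN_insert UN_empty Un_empty_right
    unfolding on_steps
    unfolding on_units
    unfolding on_lines
    unfolding row_lhs.simps bus
    unfolding row_rhs.simps sl reg flow
    unfolding soc ineq
    unfolding ball_conj_distrib
    unfolding imp_conjR all_conj_distrib ball_conj_distrib
    by (intro iffI; elim conjE; intro conjI; assumption)
qed

text \<open>The entries of the matrix \<open>A\<close>: each row form evaluated at the unit vectors.\<close>

definition coeff_A ::
  "('b, 'g, 'd, 's) power_system \<Rightarrow> ('b, 'g, 'd, 's) row \<Rightarrow> ('b, 'g, 'd, 's) yvar \<Rightarrow> real" where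
  "coeff_A ps r v = row_lhs ps r (\<lambda>w. if w = v then 1 else 0)"

lemma finite_steps: "finite (steps ps)"
  by (simp add: steps_def)

lemma finite_vars:
  assumes "wf_system ps"
  shows "finite (cont_vars ps)" "finite (bin_vars ps)"
proof -
  have "{Flow k l t |k l t. k \<in> buses ps \<and> l \<in> nbrs ps k \<and> t \<in> steps ps}
      \<subseteq> (\<lambda>(k, l, t). Flow k l t) ` (buses ps \<times> buses ps \<times> steps ps)"
    by (force simp: nbrs_def)
  then have "finite {Flow k l t |k l t. k \<in> buses ps \<and> l \<in> nbrs ps k \<and> t \<in> steps ps}"
    by (rule finite_subset) (use assms in \<open>auto simp: wf_system_def finite_steps\<close>)
  then show "finite (cont_vars ps)" "finite (bin_vars ps)"
    using assms by (auto simp: cont_vars_def bin_vars_def wf_system_def finite_steps)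
qed

lemma row_lhs_linear:
  "row_lhs ps r (\<lambda>v. a * y v + z v) = a * row_lhs ps r y + row_lhs ps r z"
  by (cases r) (simp_all add: sum.distrib sum_subtractf sum_distrib_left algebra_simps
      add_divide_distrib diff_divide_distrib)

lemma vars_iff:
  "PGreg i t \<in> cont_vars ps \<longleftrightarrow> i \<in> gens ps \<and> t \<in> steps ps"
  "PGplus i t \<in> cont_vars ps \<longleftrightarrow> i \<in> gens ps \<and> t \<in> steps ps"
  "PGminus i t \<in> cont_vars ps \<longleftrightarrow> i \<in> gens ps \<and> t \<in> steps ps"
  "PDG j t \<in> cont_vars ps \<longleftrightarrow> j \<in> dgs ps \<and> t \<in> steps ps"
  "PDGplus j t \<in> cont_vars ps \<longleftrightarrow> j \<in> dgs ps \<and> t \<in> steps ps"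
  "PDGminus j t \<in> cont_vars ps \<longleftrightarrow> j \<in> dgs ps \<and> t \<in> steps ps"
  "Psl t \<in> cont_vars ps \<longleftrightarrow> t \<in> steps ps"
  "Pch s t \<in> cont_vars ps \<longleftrightarrow> s \<in> stores ps \<and> t \<in> steps ps"
  "Pdch s t \<in> cont_vars ps \<longleftrightarrow> s \<in> stores ps \<and> t \<in> steps ps"
  "Soc s t \<in> cont_vars ps \<longleftrightarrow> s \<in> stores ps \<and> t \<in> steps ps"
  "MuCh s t \<in> bin_vars ps \<longleftrightarrow> s \<in> stores ps \<and> t \<in> steps ps"
  "MuDch s t \<in> bin_vars ps \<longleftrightarrow> s \<in> stores ps \<and> t \<in> steps ps"
  "Flow k l t \<in> cont_vars ps \<longleftrightarrow> k \<in> buses ps \<and> l \<in> nbrs ps k \<and> t \<in> steps ps"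
  "Theta k t \<in> cont_vars ps \<longleftrightarrow> k \<in> buses ps \<and> t \<in> steps ps"
  by (auto simp: cont_vars_def bin_vars_def)

lemma row_lhs_cong:
  assumes "wf_system ps" and "r \<in> eq_rows ps \<union> ge_rows ps"
    and "\<And>v. v \<in> cont_vars ps \<union> bin_vars ps \<Longrightarrow> y v = z v"
  shows "row_lhs ps r y = row_lhs ps r z"
proof -
  have eq: "y v = z v" if "v \<in> cont_vars ps \<union> bin_vars ps" for v
    using assms(3) that .
  have nb: "l \<in> nbrs ps k \<Longrightarrow> l \<in> buses ps" for k l
    by (simp add: nbrs_def)
  have prev: "t \<in> steps ps \<Longrightarrow> t \<noteq> t_first ps \<Longrightarrow> t - 1 \<in> steps ps" for t
    by (auto simp: steps_def)
  show ?thesis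
  proof (cases r)
    case (EqSoc i t)
    then have "i \<in> stores ps" "t \<in> steps ps"
      using assms(2) by (auto simp: eq_rows_def ge_rows_def)
    then show ?thesis
      using EqSoc prev[of t] by (simp add: eq vars_iff)
  next
    case (EqFlow k l t)
    then have "k \<in> buses ps" "l \<in> nbrs ps k" "t \<in> steps ps"
      using assms(2) by (auto simp: eq_rows_def ge_rows_def)
    then show ?thesis
      using EqFlow nb[of l k] by (simp add: eq vars_iff)
  qed (use assms(2) in \<open>auto simp: eq_rows_def ge_rows_def eq vars_iff\<close>)
qed

lemma row_lhs_matrix:
  assumes "wf_system ps" and "r \<in> eq_rows ps \<union> ge_rows ps"
  shows "row_lhs ps r y =
     (\<Sum>v\<in>cont_vars ps. coeff_A ps r v * y v) + (\<Sum>v\<in>bin_vars ps. coeff_A ps r v * y v)"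
proof -
  have sum_eq: "row_lhs ps r (\<lambda>w. \<Sum>v\<in>V. y v * (if w = v then 1 else 0)) = (\<Sum>v\<in>V. coeff_A ps r v * y v)"
    if "finite V" for V
    using that
  proof (induction V)
    case empty
    show ?case using row_lhs_linear[of ps r 0 "\<lambda>_. 0" "\<lambda>_. 0"] row_lhs_linear[of ps r 1 "\<lambda>_. 0" "\<lambda>_. 0"] by simp
  next
    case (insert v V)
    then show ?case
      using row_lhs_linear[of ps r "y v" "\<lambda>w. if w = v then 1 else 0"
          "\<lambda>w. \<Sum>v\<in>V. y v * (if w = v then 1 else 0)"]
      by (simp add: coeff_A_def)
  qed
  let ?V = "cont_vars ps \<union> bin_vars ps"
  have fin: "finite (cont_vars ps)" "finite (bin_vars ps)"
    using finite_vars assms(1) by auto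
  have "row_lhs ps r y = row_lhs ps r (\<lambda>w. \<Sum>v\<in>?V. y v * (if w = v then 1 else 0))"
    by (rule row_lhs_cong[OF assms]) (use fin in \<open>auto simp: if_distrib cong: if_cong\<close>)
  also have "\<dots> = (\<Sum>v\<in>?V. coeff_A ps r v * y v)"
    using sum_eq fin by blast
  also have "\<dots> = (\<Sum>v\<in>cont_vars ps. coeff_A ps r v * y v) + (\<Sum>v\<in>bin_vars ps. coeff_A ps r v * y v)"
    by (rule sum.union_disjoint) (use fin in \<open>auto simp: cont_vars_def bin_vars_def\<close>)
  finally show ?thesis .
qed

fun coeff_c :: "('b, 'g, 'd, 's) power_system \<Rightarrow> ('b, 'g, 'd, 's) yvar \<Rightarrow> real" where
  "coeff_c ps (PGplus i t) = r_plus ps i t"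
| "coeff_c ps (PGminus i t) = r_minus ps i t"
| "coeff_c ps (Psl t) = price_sl ps t"
| "coeff_c ps (PDGplus i t) = f_plus ps i"
| "coeff_c ps (PDGminus i t) = f_minus ps i"
| "coeff_c ps _ = 0"

lemma third_cost_vector:
  assumes "wf_system ps"
  shows "third_cost ps x y =
     (\<Sum>v\<in>cont_vars ps. coeff_c ps v * y v) - (\<Sum>t\<in>steps ps. price_sl ps t * Pfl x t)"
proof -
  let ?g = "\<lambda>v. coeff_c ps v * y v"
  let ?P = "\<lambda>f. \<Sum>i\<in>gens ps. \<Sum>t\<in>steps ps. ?g (f i t)"
  let ?D = "\<lambda>f. \<Sum>i\<in>dgs ps. \<Sum>t\<in>steps ps. ?g (f i t)"
  let ?C = "case_prod PGplus ` (gens ps \<times> steps ps) \<union> (case_prod PGminus ` (gens ps \<times> steps ps)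
     \<union> (case_prod PDGplus ` (dgs ps \<times> steps ps) \<union> (case_prod PDGminus ` (dgs ps \<times> steps ps)
     \<union> Psl ` steps ps)))"
  have fin: "finite (gens ps)" "finite (dgs ps)" "finite (steps ps)"
    using assms by (auto simp: wf_system_def finite_steps)
  have "sum ?g (cont_vars ps) = sum ?g ?C"
    by (rule sum.mono_neutral_right) (use finite_vars assms in \<open>auto simp: cont_vars_def\<close>)
  also have "\<dots> = sum ?g (case_prod PGplus ` (gens ps \<times> steps ps))
      + (sum ?g (case_prod PGminus ` (gens ps \<times> steps ps))
      + (sum ?g (case_prod PDGplus ` (dgs ps \<times> steps ps))
      + (sum ?g (case_prod PDGminus ` (dgs ps \<times> steps ps))
      + sum ?g (Psl ` steps ps))))"
    using fin by (subst sum.union_disjoint; (auto; fail)?)+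
  also have "\<dots> = ?P PGplus + (?P PGminus + (?D PDGplus + (?D PDGminus
      + (\<Sum>t\<in>steps ps. ?g (Psl t)))))"
    by (simp add: sum.reindex inj_on_def sum.cartesian_product split_def comp_def)
  finally show ?thesis
    unfolding third_cost_def
    by (simp add: sum.distrib sum_subtractf algebra_simps sum.swap[of _ _ "steps ps"])
qed

text \<open>
  With the binaries fixed to \<open>\<mu>\<close>, their columns are moved to the right-hand side and only the
  continuous variables, all free, remain.  Hence a dual solution \<open>(lam, \<beta>)\<close> has \<open>lam\<close> free on
  equations and nonnegative on inequalities, \<open>\<beta> \<ge> 0\<close> on the rows \<open>- P\<^sub>D\<^sub>G \<ge> - h\<close>,
  and satisfies one equation per continuous variable.
\<close>

fun DG_column :: "('d \<Rightarrow> int \<Rightarrow> real) \<Rightarrow> ('b, 'g, 'd, 's) yvar \<Rightarrow> real" where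
  "DG_column \<beta> (PDG i t) = - \<beta> i t"
| "DG_column \<beta> _ = 0"

definition dual_set ::
  "('b, 'g, 'd, 's) power_system \<Rightarrow> ((('b, 'g, 'd, 's) row \<Rightarrow> real) \<times> ('d \<Rightarrow> int \<Rightarrow> real)) set" where
  "dual_set ps = {(lam, \<beta>).
     (\<forall>r\<in>ge_rows ps. lam r \<ge> 0) \<and>
     (\<forall>i\<in>dgs ps. \<forall>t\<in>steps ps. \<beta> i t \<ge> 0) \<and>
     (\<forall>v\<in>cont_vars ps.
        (\<Sum>r\<in>eq_rows ps \<union> ge_rows ps. coeff_A ps r v * lam r) + DG_column \<beta> v = coeff_c ps v)}"

definition dual_obj ::
  "('b, 'g, 'd, 's) power_system \<Rightarrow> ('b, 'g, 'd, 's) yvec \<Rightarrow> 'g first_stage \<Rightarrow> ('d \<Rightarrow> int \<Rightarrow> real)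
     \<Rightarrow> (('b, 'g, 'd, 's) row \<Rightarrow> real) \<Rightarrow> ('d \<Rightarrow> int \<Rightarrow> real) \<Rightarrow> real" where
  "dual_obj ps \<mu> x h lam \<beta> =
     (\<Sum>r\<in>eq_rows ps \<union> ge_rows ps.
        lam r * (row_rhs ps x r - (\<Sum>v\<in>bin_vars ps. coeff_A ps r v * \<mu> v)))
     - (\<Sum>i\<in>dgs ps. \<Sum>t\<in>steps ps. h i t * \<beta> i t)
     - (\<Sum>t\<in>steps ps. price_sl ps t * Pfl x t)"

definition fixed_trilevel_value ::
  "('b, 'g, 'd, 's) power_system \<Rightarrow> ('b, 'g, 'd, 's) yvec \<Rightarrow> ereal" where
  "fixed_trilevel_value ps \<mu> =
     (INF x\<in>first_set ps. ereal (first_cost ps x)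
        + (SUP h\<in>Omega ps. INF y\<in>{y \<in> third_set ps x h. \<forall>v\<in>bin_vars ps. y v = \<mu> v}.
             ereal (third_cost ps x y)))"

definition bounded_dual_value ::
  "('b, 'g, 'd, 's) power_system \<Rightarrow> ('d \<Rightarrow> int \<Rightarrow> real) \<Rightarrow> ('d \<Rightarrow> int \<Rightarrow> real) \<Rightarrow> ('d \<Rightarrow> int \<Rightarrow> real)
     \<Rightarrow> ('b, 'g, 'd, 's) yvec \<Rightarrow> ereal" where
  "bounded_dual_value ps Pplus \<beta>m \<beta>p \<mu> =
     (INF x\<in>first_set ps. ereal (first_cost ps x)
        + (SUP h\<in>{h \<in> Omega ps. \<forall>i\<in>dgs ps. \<forall>t\<in>steps ps. PDG_min ps i t \<le> h i t \<and> h i t \<le> Pplus i t}.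
           SUP (lam, \<beta>)\<in>{(lam, \<beta>) \<in> dual_set ps.
                         \<forall>i\<in>dgs ps. \<forall>t\<in>steps ps. \<beta>m i t \<le> \<beta> i t \<and> \<beta> i t \<le> \<beta>p i t}.
             ereal (dual_obj ps \<mu> x h lam \<beta>)))"

text \<open>
  The bounds \<open>Pplus i t\<close> on \<open>h\<close> are not the technical limits \<open>PDG_limit i\<close> of the set \<open>Omega\<close>.
\<close>

definition boundedness_assumption ::
  "('b, 'g, 'd, 's) power_system \<Rightarrow> ('d \<Rightarrow> int \<Rightarrow> real) \<Rightarrow> ('d \<Rightarrow> int \<Rightarrow> real) \<Rightarrow> ('d \<Rightarrow> int \<Rightarrow> real)
     \<Rightarrow> bool" where
  "boundedness_assumption ps Pplus \<beta>m \<beta>p \<longleftrightarrow>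
     (\<forall>i\<in>dgs ps. \<forall>t\<in>steps ps. \<beta>m i t \<le> \<beta>p i t) \<and>
     (\<forall>\<mu>. binary ps \<mu> \<longrightarrow> fixed_trilevel_value ps \<mu> = bounded_dual_value ps Pplus \<beta>m \<beta>p \<mu>)"


section \<open>The mixed-integer program\<close>

record ('d, 'm) mip_aux =
  u_bplus :: "'d \<Rightarrow> int \<Rightarrow> real"
  u_bminus :: "'d \<Rightarrow> int \<Rightarrow> real"
  u_Omega :: "'m \<Rightarrow> real"
  u_1 :: "'d \<Rightarrow> int \<Rightarrow> real"
  u_2 :: "'d \<Rightarrow> int \<Rightarrow> real"
  u_3 :: "'d \<Rightarrow> int \<Rightarrow> real"
  u_4 :: "'d \<Rightarrow> int \<Rightarrow> real"

text \<open>
  \<open>M\<close> indexes the rows of \<open>A\<^sub>\<Omega>\<^sup>T P + \<eta> = b\<^sub>\<Omega>\<close>, and \<open>AO i t m\<close> is the entry of the matrix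
  \<open>A\<^sub>\<Omega>\<close> in row \<open>(i, t)\<close> and column \<open>m\<close>.
\<close>

definition slack_polytope ::
  "('b, 'g, 'd, 's) power_system \<Rightarrow> 'm set \<Rightarrow> ('d \<Rightarrow> int \<Rightarrow> 'm \<Rightarrow> real) \<Rightarrow> ('m \<Rightarrow> real)
     \<Rightarrow> ('d \<Rightarrow> int \<Rightarrow> real) set" where
  "slack_polytope ps M AO bO = {P.
     (\<forall>i\<in>dgs ps. \<forall>t\<in>steps ps. P i t \<ge> 0) \<and>
     (\<exists>\<eta>. (\<forall>m\<in>M. \<eta> m \<ge> 0) \<and>
          (\<forall>m\<in>M. (\<Sum>i\<in>dgs ps. \<Sum>t\<in>steps ps. AO i t m * P i t) + \<eta> m = bO m))}"

definition mip_set ::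
  "('b, 'g, 'd, 's) power_system \<Rightarrow> 'm set \<Rightarrow> ('d \<Rightarrow> int \<Rightarrow> 'm \<Rightarrow> real)
     \<Rightarrow> ('d \<Rightarrow> int \<Rightarrow> real) \<Rightarrow> ('d \<Rightarrow> int \<Rightarrow> real) \<Rightarrow> ('d \<Rightarrow> int \<Rightarrow> real)
     \<Rightarrow> ('g first_stage \<times> ('b, 'g, 'd, 's) yvec \<times> ('d, 'm) mip_aux) set" where
  "mip_set ps M AO Pplus \<beta>m \<beta>p = {(x, y, u).
     Ay_ge_b ps x y \<and>
     (\<forall>i\<in>dgs ps. \<forall>t\<in>steps ps.
        - y (PDG i t) + u_bplus u i t + u_bminus u i t
          - PDG_min ps i t * u_1 u i t - Pplus i t * u_2 u i t
          - Pplus i t * u_3 u i t - PDG_min ps i t * u_4 u i t \<ge> 0 \<and>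
        u_bplus u i t \<ge> 0 \<and> - u_bminus u i t \<ge> 0 \<and>
        (\<Sum>m\<in>M. AO i t m * u_Omega u m)
          - \<beta>m i t * (u_1 u i t + u_3 u i t) - \<beta>p i t * (u_2 u i t + u_4 u i t) \<ge> 0 \<and>
        u_1 u i t + u_2 u i t + u_3 u i t + u_4 u i t \<ge> - 1 \<and>
        - u_1 u i t \<ge> 0 \<and> - u_2 u i t \<ge> 0 \<and> u_3 u i t \<ge> 0 \<and> u_4 u i t \<ge> 0) \<and>
     (\<forall>m\<in>M. u_Omega u m \<ge> 0) \<and>
     x \<in> first_set ps \<and>
     binary ps y}"

definition mip_obj ::
  "('b, 'g, 'd, 's) power_system \<Rightarrow> 'm set \<Rightarrow> ('m \<Rightarrow> real)
     \<Rightarrow> ('d \<Rightarrow> int \<Rightarrow> real) \<Rightarrow> ('d \<Rightarrow> int \<Rightarrow> real) \<Rightarrow> ('d \<Rightarrow> int \<Rightarrow> real)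
     \<Rightarrow> 'g first_stage \<Rightarrow> ('b, 'g, 'd, 's) yvec \<Rightarrow> ('d, 'm) mip_aux \<Rightarrow> real" where
  "mip_obj ps M bO Pplus \<beta>m \<beta>p x y u =
     (\<Sum>i\<in>gens ps. \<Sum>t\<in>steps ps.
        cost_G2 ps i t * (PG x i t)\<^sup>2 + cost_G1 ps i t * PG x i t + cost_G0 ps i t)
     + (\<Sum>t\<in>steps ps. price_fl ps t * Pfl x t)
     + third_cost ps x y
     + (\<Sum>i\<in>dgs ps. \<Sum>t\<in>steps ps. \<beta>p i t * u_bplus u i t + \<beta>m i t * u_bminus u i t)
     + (\<Sum>m\<in>M. bO m * u_Omega u m)
     - (\<Sum>i\<in>dgs ps. \<Sum>t\<in>steps ps.
          PDG_min ps i t * \<beta>m i t * u_1 u i t + Pplus i t * \<beta>p i t * u_2 u i t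
          + Pplus i t * \<beta>m i t * u_3 u i t + PDG_min ps i t * \<beta>p i t * u_4 u i t)"

definition mip_value ::
  "('b, 'g, 'd, 's) power_system \<Rightarrow> 'm set \<Rightarrow> ('d \<Rightarrow> int \<Rightarrow> 'm \<Rightarrow> real) \<Rightarrow> ('m \<Rightarrow> real)
     \<Rightarrow> ('d \<Rightarrow> int \<Rightarrow> real) \<Rightarrow> ('d \<Rightarrow> int \<Rightarrow> real) \<Rightarrow> ('d \<Rightarrow> int \<Rightarrow> real) \<Rightarrow> ereal" where
  "mip_value ps M AO bO Pplus \<beta>m \<beta>p =
     (INF (x, y, u)\<in>mip_set ps M AO Pplus \<beta>m \<beta>p. ereal (mip_obj ps M bO Pplus \<beta>m \<beta>p x y u))"

end

theory Submission
  imports Defs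
begin

text \<open>
  The bound is two weak dualities placed one after the other.  Take a feasible point \<open>(x, y, u)\<close> of
  the mixed-integer program and fix the binaries of the third level to those of \<open>y\<close>.  Fixing them
  shrinks the innermost feasible sets and so can only raise the trilevel value; by the boundedness
  assumption the raised value is a minimum over \<open>x\<close> of a maximum over \<open>h\<close> and dual solutions
  \<open>(lam, \<beta>)\<close> that obey the additional bounds.  So it is enough to bound the dual objective at \<open>x\<close>
  by the objective of the program, for every such \<open>h\<close> and \<open>(lam, \<beta>)\<close>.

  Weak duality for the third-level LP, in which \<open>y\<close> need not satisfy \<open>P\<^sub>D\<^sub>G \<le> h\<close>, bounds the dual
  objective by \<open>c\<^sup>T y + \<Sum> \<beta> (P\<^sub>D\<^sub>G - h)\<close> (\<open>dual_obj_le_lagrangian\<close>).  What is left is bilinear in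
  \<open>(h, \<beta>)\<close>.  The products \<open>h \<beta>\<close> over the box of bounds obey the four McCormick inequalities, which
  are linear in \<open>h\<close>, \<open>\<beta>\<close> and \<open>h \<beta>\<close>, and \<open>u\<close> consists of multipliers for them and for the
  remaining linear constraints: \<open>u\<^sup>1, \<dots>, u\<^sup>4\<close> for the McCormick inequalities, \<open>u\<^sup>\<beta>\<^sup>,\<^sup>\<plusminus>\<close> for the
  bounds on \<open>\<beta>\<close>, \<open>u\<^sub>\<Omega>\<close> for the rows of \<open>\<Omega>\<close>.  Adding up with these multipliers is weak duality for
  the McCormick relaxation of the inner maximum; it is done for one pair \<open>(i, t)\<close> at a time in
  \<open>mccormick_multiplier_bound\<close>, and \<open>slack_polytope_weak_duality\<close> handles the coupling through \<open>\<Omega>\<close>.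
\<close>

text \<open>
  Here \<open>y\<close> may violate \<open>P\<^sub>D\<^sub>G \<le> h\<close>, so the rows \<open>- P\<^sub>D\<^sub>G \<ge> - h\<close> are left unpaired and survive
  as a Lagrangian term.  Pairing the rows of \<open>A y \<ge> b\<close> with \<open>lam\<close> and exchanging the order of
  summation lets the dual equations turn them into \<open>c\<^sup>T y\<close> plus the contribution of the \<open>P\<^sub>D\<^sub>G\<close>
  columns.
\<close>

lemma dual_obj_le_lagrangian:
  assumes wf: "wf_system ps"
    and Ay: "Ay_ge_b ps x y"
    and dual: "(lam, \<beta>) \<in> dual_set ps"
  shows "dual_obj ps y x h lam \<beta>
    \<le> third_cost ps x y + (\<Sum>i\<in>dgs ps. \<Sum>t\<in>steps ps. \<beta> i t * (y (PDG i t) - h i t))"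
proof -
  let ?R = "eq_rows ps \<union> ge_rows ps" and ?C = "cont_vars ps"
  have fin: "finite ?C"
    using finite_vars[OF wf] by simp
  have "lam r * (row_rhs ps x r - (\<Sum>v\<in>bin_vars ps. coeff_A ps r v * y v))
      \<le> lam r * (\<Sum>v\<in>?C. coeff_A ps r v * y v)" if r: "r \<in> ?R" for r
  proof (cases "r \<in> eq_rows ps")
    case True
    then have "row_rhs ps x r = row_lhs ps r y"
      using Ay wf by (simp add: Ay_ge_b_rows)
    then show ?thesis
      using row_lhs_matrix[OF wf r, of y] by simp
  next
    case False
    then have "row_rhs ps x r \<le> row_lhs ps r y" "lam r \<ge> 0"
      using Ay wf dual r by (auto simp: Ay_ge_b_rows dual_set_def)
    then show ?thesis
      using row_lhs_matrix[OF wf r, of y] by (intro mult_left_mono) auto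
  qed
  then have "(\<Sum>r\<in>?R. lam r * (row_rhs ps x r - (\<Sum>v\<in>bin_vars ps. coeff_A ps r v * y v)))
      \<le> (\<Sum>r\<in>?R. lam r * (\<Sum>v\<in>?C. coeff_A ps r v * y v))"
    by (rule sum_mono)
  also have "\<dots> = (\<Sum>v\<in>?C. (\<Sum>r\<in>?R. coeff_A ps r v * lam r) * y v)"
    unfolding sum_distrib_left sum_distrib_right
    by (subst sum.swap) (simp add: mult_ac)
  also have "\<dots> = (\<Sum>v\<in>?C. (coeff_c ps v - DG_column \<beta> v) * y v)"
  proof (rule sum.cong[OF refl])
    fix v assume "v \<in> ?C"
    then have "(\<Sum>r\<in>?R. coeff_A ps r v * lam r) + DG_column \<beta> v = coeff_c ps v"
      using dual by (simp add: dual_set_def)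
    then have "(\<Sum>r\<in>?R. coeff_A ps r v * lam r) = coeff_c ps v - DG_column \<beta> v"
      by linarith
    then show "(\<Sum>r\<in>?R. coeff_A ps r v * lam r) * y v = (coeff_c ps v - DG_column \<beta> v) * y v"
      by (rule arg_cong)
  qed
  also have "\<dots> = (\<Sum>v\<in>?C. coeff_c ps v * y v) - (\<Sum>v\<in>?C. DG_column \<beta> v * y v)"
    by (simp add: left_diff_distrib sum_subtractf)
  also have "(\<Sum>v\<in>?C. DG_column \<beta> v * y v)
      = (\<Sum>v\<in>case_prod PDG ` (dgs ps \<times> steps ps). DG_column \<beta> v * y v)"
    by (rule sum.mono_neutral_right[OF fin]) (auto simp: cont_vars_def)
  also have "\<dots> = - (\<Sum>i\<in>dgs ps. \<Sum>t\<in>steps ps. \<beta> i t * y (PDG i t))"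
    by (simp add: sum.reindex inj_on_def sum.cartesian_product split_def comp_def sum_negf)
  finally show ?thesis
    unfolding dual_obj_def third_cost_vector[OF wf]
    by (simp add: algebra_simps sum_subtractf)
qed

text \<open>
  On the box \<open>[a, b] \<times> [\<beta>m, \<beta>p]\<close> each McCormick inequality says that the product of a distance
  of \<open>h\<close> and a distance of \<open>\<beta>\<close> to a bound is nonnegative.  Weighted with \<open>- u1\<close>, \<open>- u2\<close>, \<open>u3\<close>
  and \<open>u4\<close> they add up to \<open>h * \<beta> * (u1 + u2 + u3 + u4)\<close> being at most terms linear in \<open>h\<close> and in
  \<open>\<beta>\<close>, and \<open>h * \<beta> \<ge> 0\<close> makes the left-hand side at least \<open>- h * \<beta>\<close>.
\<close>

lemma mccormick_multiplier_bound:
  fixes h \<beta> :: real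
  assumes box: "a \<le> h" "h \<le> b" "\<beta>m \<le> \<beta>" "\<beta> \<le> \<beta>p"
    and nonneg: "0 \<le> h" "0 \<le> \<beta>"
    and p: "p \<le> up + um - a * u1 - b * u2 - b * u3 - a * u4"
    and signs: "0 \<le> up" "um \<le> 0" "u1 \<le> 0" "u2 \<le> 0" "0 \<le> u3" "0 \<le> u4"
    and total: "- 1 \<le> u1 + u2 + u3 + u4"
    and w: "\<beta>m * (u1 + u3) + \<beta>p * (u2 + u4) \<le> w"
  shows "\<beta> * (p - h) \<le> \<beta>p * up + \<beta>m * um + h * w
    - (a * \<beta>m * u1 + b * \<beta>p * u2 + b * \<beta>m * u3 + a * \<beta>p * u4)"
proof -
  have "u1 * ((h - a) * (\<beta> - \<beta>m)) \<le> 0" "u2 * ((b - h) * (\<beta>p - \<beta>)) \<le> 0"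
    "0 \<le> u3 * ((b - h) * (\<beta> - \<beta>m))" "0 \<le> u4 * ((h - a) * (\<beta>p - \<beta>))"
    using box signs by (auto intro!: mult_nonpos_nonneg mult_nonneg_nonneg)
  moreover have "0 \<le> (h * \<beta>) * (u1 + u2 + u3 + u4 + 1)"
    using nonneg total by (intro mult_nonneg_nonneg) auto
  moreover have "\<beta> * p \<le> \<beta> * (up + um - a * u1 - b * u2 - b * u3 - a * u4)"
    using p nonneg by (intro mult_left_mono)
  moreover have "h * (\<beta>m * (u1 + u3) + \<beta>p * (u2 + u4)) \<le> h * w"
    using w nonneg by (intro mult_left_mono)
  moreover have "\<beta> * up \<le> \<beta>p * up" "\<beta> * um \<le> \<beta>m * um"
    using box signs by (auto intro: mult_right_mono mult_right_mono_neg)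
  ultimately show ?thesis
    by (simp add: algebra_simps)
qed

lemma slack_polytope_weak_duality:
  assumes h: "h \<in> slack_polytope ps M AO bO"
    and v: "\<And>m. m \<in> M \<Longrightarrow> v m \<ge> 0"
  shows "(\<Sum>i\<in>dgs ps. \<Sum>t\<in>steps ps. h i t * (\<Sum>m\<in>M. AO i t m * v m)) \<le> (\<Sum>m\<in>M. bO m * v m)"
proof -
  have row: "(\<Sum>i\<in>dgs ps. \<Sum>t\<in>steps ps. AO i t m * h i t) \<le> bO m" if "m \<in> M" for m
    using h that unfolding slack_polytope_def by force
  have "(\<Sum>i\<in>dgs ps. \<Sum>t\<in>steps ps. h i t * (\<Sum>m\<in>M. AO i t m * v m))
      = (\<Sum>i\<in>dgs ps. \<Sum>m\<in>M. \<Sum>t\<in>steps ps. AO i t m * h i t * v m)"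
    unfolding sum_distrib_left by (subst sum.swap) (simp add: mult_ac)
  also have "\<dots> = (\<Sum>m\<in>M. (\<Sum>i\<in>dgs ps. \<Sum>t\<in>steps ps. AO i t m * h i t) * v m)"
    unfolding sum_distrib_right by (rule sum.swap)
  also have "\<dots> \<le> (\<Sum>m\<in>M. bO m * v m)"
    using row v by (intro sum_mono mult_right_mono)
  finally show ?thesis .
qed

lemma trilevel_value_le_fixed:
  "trilevel_value ps \<le> fixed_trilevel_value ps \<mu>"
  unfolding trilevel_value_def fixed_trilevel_value_def
  by (intro INF_mono' add_left_mono SUP_mono' INF_superset_mono) auto

text \<open>
  Both weak dualities combined: whatever admissible \<open>h\<close> and bounded dual solution the inner
  maximisation chooses, its gain is covered by the terms that the program adds to the first-level
  cost.
\<close>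

lemma dual_obj_le_mip_obj:
  assumes wf: "wf_system ps"
    and Omega: "Omega ps = slack_polytope ps M AO bO"
    and mip: "(x, y, u) \<in> mip_set ps M AO Pplus \<beta>m \<beta>p"
    and h: "h \<in> Omega ps"
    and h_box: "\<And>i t. i \<in> dgs ps \<Longrightarrow> t \<in> steps ps \<Longrightarrow> PDG_min ps i t \<le> h i t \<and> h i t \<le> Pplus i t"
    and dual: "(lam, \<beta>) \<in> dual_set ps"
    and \<beta>_box: "\<And>i t. i \<in> dgs ps \<Longrightarrow> t \<in> steps ps \<Longrightarrow> \<beta>m i t \<le> \<beta> i t \<and> \<beta> i t \<le> \<beta>p i t"
  shows "first_cost ps x + dual_obj ps y x h lam \<beta> \<le> mip_obj ps M bO Pplus \<beta>m \<beta>p x y u"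
proof -
  let ?S = "\<lambda>f. \<Sum>i\<in>dgs ps. \<Sum>t\<in>steps ps. f i t :: real"
  define w where "w i t = (\<Sum>m\<in>M. AO i t m * u_Omega u m)" for i t
  define bounds where "bounds i t = \<beta>p i t * u_bplus u i t + \<beta>m i t * u_bminus u i t" for i t
  define corners where "corners i t = PDG_min ps i t * \<beta>m i t * u_1 u i t
      + Pplus i t * \<beta>p i t * u_2 u i t + Pplus i t * \<beta>m i t * u_3 u i t
      + PDG_min ps i t * \<beta>p i t * u_4 u i t" for i t
  have "\<beta> i t * (y (PDG i t) - h i t) \<le> bounds i t + h i t * w i t - corners i t"
    if it: "i \<in> dgs ps" "t \<in> steps ps" for i t
  proof -
    have "h i t \<ge> 0" "\<beta> i t \<ge> 0"
      using h dual it by (auto simp: Omega_def dual_set_def)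
    moreover have "- y (PDG i t) + u_bplus u i t + u_bminus u i t
          - PDG_min ps i t * u_1 u i t - Pplus i t * u_2 u i t
          - Pplus i t * u_3 u i t - PDG_min ps i t * u_4 u i t \<ge> 0"
      "u_bplus u i t \<ge> 0" "- u_bminus u i t \<ge> 0"
      "w i t - \<beta>m i t * (u_1 u i t + u_3 u i t) - \<beta>p i t * (u_2 u i t + u_4 u i t) \<ge> 0"
      "u_1 u i t + u_2 u i t + u_3 u i t + u_4 u i t \<ge> - 1"
      "- u_1 u i t \<ge> 0" "- u_2 u i t \<ge> 0" "u_3 u i t \<ge> 0" "u_4 u i t \<ge> 0"
      using mip it by (simp_all add: mip_set_def w_def)
    ultimately show ?thesis
      unfolding bounds_def corners_def
      using h_box[OF it] \<beta>_box[OF it] by (intro mccormick_multiplier_bound) linarith+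
  qed
  then have "?S (\<lambda>i t. \<beta> i t * (y (PDG i t) - h i t))
      \<le> ?S (\<lambda>i t. bounds i t + h i t * w i t - corners i t)"
    by (intro sum_mono)
  also have "\<dots> = ?S bounds + ?S (\<lambda>i t. h i t * w i t) - ?S corners"
    by (simp add: sum.distrib sum_subtractf)
  also have "?S (\<lambda>i t. h i t * w i t) \<le> (\<Sum>m\<in>M. bO m * u_Omega u m)"
    unfolding w_def
    using slack_polytope_weak_duality[of h ps M AO bO "u_Omega u"] h mip
    by (simp add: Omega mip_set_def)
  finally have "?S (\<lambda>i t. \<beta> i t * (y (PDG i t) - h i t))
      \<le> ?S bounds + (\<Sum>m\<in>M. bO m * u_Omega u m) - ?S corners"
    by simp
  moreover have "dual_obj ps y x h lam \<beta>
      \<le> third_cost ps x y + ?S (\<lambda>i t. \<beta> i t * (y (PDG i t) - h i t))"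
    using mip by (intro dual_obj_le_lagrangian wf dual) (simp add: mip_set_def)
  ultimately show ?thesis
    unfolding first_cost_def mip_obj_def bounds_def corners_def by linarith
qed

theorem corollary2:
  fixes ps :: "('b, 'g, 'd, 's) power_system"
    and M :: "'m set"
    and A_Omega :: "'d \<Rightarrow> int \<Rightarrow> 'm \<Rightarrow> real"
    and b_Omega :: "'m \<Rightarrow> real"
    and P_plus \<beta>_minus \<beta>_plus :: "'d \<Rightarrow> int \<Rightarrow> real"
  assumes "wf_system ps"
    and "finite M"
    and "Omega ps = slack_polytope ps M A_Omega b_Omega"
    and "boundedness_assumption ps P_plus \<beta>_minus \<beta>_plus"
  shows "trilevel_value ps \<le> mip_value ps M A_Omega b_Omega P_plus \<beta>_minus \<beta>_plus"
proof -
  have "trilevel_value ps \<le> ereal (mip_obj ps M b_Omega P_plus \<beta>_minus \<beta>_plus x y u)"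
    if mip: "(x, y, u) \<in> mip_set ps M A_Omega P_plus \<beta>_minus \<beta>_plus" for x y u
  proof -
    let ?obj = "mip_obj ps M b_Omega P_plus \<beta>_minus \<beta>_plus x y u"
    have x: "x \<in> first_set ps" and bin: "binary ps y"
      using mip by (simp_all add: mip_set_def)
    have dual: "ereal (dual_obj ps y x h lam \<beta>) \<le> ereal (?obj - first_cost ps x)"
      if "h \<in> {h \<in> Omega ps. \<forall>i\<in>dgs ps. \<forall>t\<in>steps ps. PDG_min ps i t \<le> h i t \<and> h i t \<le> P_plus i t}"
        and "(lam, \<beta>) \<in> dual_set ps"
        and "\<forall>i\<in>dgs ps. \<forall>t\<in>steps ps. \<beta>_minus i t \<le> \<beta> i t \<and> \<beta> i t \<le> \<beta>_plus i t" for h lam \<beta>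
      using dual_obj_le_mip_obj[OF assms(1,3) mip, of h lam \<beta>] that by simp
    have "trilevel_value ps \<le> fixed_trilevel_value ps y"
      by (rule trilevel_value_le_fixed)
    also have "\<dots> = bounded_dual_value ps P_plus \<beta>_minus \<beta>_plus y"
      using assms(4) bin by (simp add: boundedness_assumption_def)
    also have "\<dots> \<le> ereal (first_cost ps x) + ereal (?obj - first_cost ps x)"
      unfolding bounded_dual_value_def
      by (rule INF_lower2[OF x]) (intro add_left_mono SUP_least, use dual in auto)
    finally show ?thesis
      by simp
  qed
  then show ?thesis
    unfolding mip_value_def by (intro INF_greatest) auto
qed

end
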